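(* Let $R$ be an associative ring (not necessarily unital), let $a,b,c\in R$, and suppose that $x_l\in R$ is a left annihilator $(b,c)$-inverse of $a$ and $x_r\in R$ is a right annihilator $(b,c)$-inverse of $a$. Then $a$ is annihilator $(b,c)$-invertible, and its annihilator $(b,c)$-inverse is $x_l a x_r$.
   Context: For $u\in R$ write ${}^{\circ}u=\{r\in R: ru=0\}$ and $u^{\circ}=\{r\in R: ur=0\}$. An element $x\in R$ is an annihilator $(b,c)$-inverse of $a$ if $xax=x$, $xab=b$, $cax=c$, ${}^{\circ}b\subseteq{}^{\circ}x$, and $c^{\circ}\subseteq x^{\circ}$; such $x$ is unique when it exists, and $a$ is then called annihilator $(b,c)$-invertible. An element $x\in R$ is a left annihilator $(b,c)$-inverse of $a$ if $xab=b$ and $c^{\circ}\subseteq x^{\circ}$. An element $y\in R$ is a right annihilator $(b,c)$-inverse of $a$ if $cay=c$ and ${}^{\circ}b\subseteq{}^{\circ}y$. *)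

theory Defs
  imports Main
begin

(* The type class ring is the class of associative rings, commutative under addition
   and not assumed to have a unit element or to be commutative under multiplication. *)

definition left_annihilator :: "'a::ring \<Rightarrow> 'a set" where
  "left_annihilator u = {r. r * u = 0}"

definition right_annihilator :: "'a::ring \<Rightarrow> 'a set" where
  "right_annihilator u = {r. u * r = 0}"

text \<open>In the predicates below the arguments are \<open>a\<close>, then the pair \<open>b\<close>, \<open>c\<close>, then the
  candidate inverse of \<open>a\<close>.\<close>

definition is_annihilator_inverse :: "'a::ring \<Rightarrow> 'a \<Rightarrow> 'a \<Rightarrow> 'a \<Rightarrow> bool" where
  "is_annihilator_inverse a b c x \<longleftrightarrow>
     x * a * x = x \<and> x * a * b = b \<and> c * a * x = c \<and>
     left_annihilator b \<subseteq> left_annihilator x \<and>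
     right_annihilator c \<subseteq> right_annihilator x"

definition is_left_annihilator_inverse :: "'a::ring \<Rightarrow> 'a \<Rightarrow> 'a \<Rightarrow> 'a \<Rightarrow> bool" where
  "is_left_annihilator_inverse a b c x \<longleftrightarrow>
     x * a * b = b \<and> right_annihilator c \<subseteq> right_annihilator x"

definition is_right_annihilator_inverse :: "'a::ring \<Rightarrow> 'a \<Rightarrow> 'a \<Rightarrow> 'a \<Rightarrow> bool" where
  "is_right_annihilator_inverse a b c y \<longleftrightarrow>
     c * a * y = c \<and> left_annihilator b \<subseteq> left_annihilator y"

definition annihilator_invertible :: "'a::ring \<Rightarrow> 'a \<Rightarrow> 'a \<Rightarrow> bool" where
  "annihilator_invertible a b c \<longleftrightarrow> (\<exists>x. is_annihilator_inverse a b c x)"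

lemma is_annihilator_inverse_unique:
  assumes x: "is_annihilator_inverse a b c x" and y: "is_annihilator_inverse a b c y"
  shows "x = y"
proof -
  have "c * (a * x - a * y) = 0"
    using x y by (simp add: is_annihilator_inverse_def algebra_simps)
  then have "x * (a * x - a * y) = 0"
    using x by (auto simp: is_annihilator_inverse_def right_annihilator_def)
  then have 1: "x = x * a * y"
    using x by (simp add: is_annihilator_inverse_def algebra_simps)
  have "(x * a - y * a) * b = 0"
    using x y by (simp add: is_annihilator_inverse_def algebra_simps)
  then have "(x * a - y * a) * y = 0"
    using y by (auto simp: is_annihilator_inverse_def left_annihilator_def)
  then have "x * a * y = y"
    using y by (simp add: is_annihilator_inverse_def algebra_simps)
  with 1 show ?thesis by simp
qed

text \<open>Meaningful only when \<open>annihilator_invertible a b c\<close> holds; the description is then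
  proper by \<open>is_annihilator_inverse_unique\<close>.\<close>

definition annihilator_inverse :: "'a::ring \<Rightarrow> 'a \<Rightarrow> 'a \<Rightarrow> 'a" where
  "annihilator_inverse a b c = (THE x. is_annihilator_inverse a b c x)"

end

theory Submission imports Defs begin

text \<open>In a unital ring the hypotheses force \<open>x_l = x_l * a * x_r = x_r\<close>: since
  \<open>c * (a * x_r - 1) = 0\<close>, the inclusion of right annihilators gives
  \<open>x_l * (a * x_r - 1) = 0\<close>, and dually \<open>(x_l * a - 1) * x_r = 0\<close>. Without a unit the
  factors \<open>a * x_r - 1\<close> and \<open>x_l * a - 1\<close> make sense only after multiplication by a ring
  element, so what survives is that \<open>x_l * a * x_r\<close> acts as \<open>x_l\<close> by left multiplication
  (\<open>left_inverse_absorbs\<close>) and as \<open>x_r\<close> by right multiplication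
  (\<open>right_inverse_absorbs\<close>). Every defining condition of an annihilator inverse except
  \<open>x * a * x = x\<close> is about products of \<open>x\<close> with another element on one side, so it passes
  from \<open>x_l\<close> or \<open>x_r\<close> to \<open>x_l * a * x_r\<close>; and \<open>x * a * x = x\<close> follows by absorbing on each
  side in turn.\<close>

text \<open>The element \<open>a * y * r - r\<close> plays the role of \<open>(a * y - 1) * r\<close>: it lies in the right
  annihilator of \<open>c\<close>, hence in that of \<open>x\<close>.\<close>

lemma left_inverse_absorbs:
  fixes a c x y r :: "'a::ring"
  assumes cay: "c * a * y = c"
    and sub: "right_annihilator c \<subseteq> right_annihilator x"
  shows "x * a * y * r = x * r"
proof -
  have "c * (a * y * r - r) = c * a * y * r - c * r"
    by (simp add: right_diff_distrib mult.assoc)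
  then have "a * y * r - r \<in> right_annihilator c"
    using cay by (simp add: right_annihilator_def)
  then have "x * (a * y * r - r) = 0"
    using sub by (auto simp: right_annihilator_def)
  then show ?thesis
    by (simp add: right_diff_distrib mult.assoc)
qed

lemma right_inverse_absorbs:
  fixes a b x y s :: "'a::ring"
  assumes xab: "x * a * b = b"
    and sub: "left_annihilator b \<subseteq> left_annihilator y"
  shows "s * (x * a * y) = s * y"
proof -
  have "(s * x * a - s) * b = s * (x * a * b) - s * b"
    by (simp add: left_diff_distrib mult.assoc)
  then have "s * x * a - s \<in> left_annihilator b"
    using xab by (simp add: left_annihilator_def)
  then have "(s * x * a - s) * y = 0"
    using sub by (auto simp: left_annihilator_def)
  then show ?thesis
    by (simp add: left_diff_distrib mult.assoc)
qed

lemma annihilator_inverse_eqI: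
  assumes "is_annihilator_inverse a b c x"
  shows "annihilator_inverse a b c = x"
  unfolding annihilator_inverse_def
  using assms by (blast intro: the_equality is_annihilator_inverse_unique)

theorem theorem2p5:
  fixes a b c x_l x_r :: "'a::ring"
  assumes "is_left_annihilator_inverse a b c x_l"
    and "is_right_annihilator_inverse a b c x_r"
  shows "annihilator_invertible a b c \<and>
         is_annihilator_inverse a b c (x_l * a * x_r) \<and>
         annihilator_inverse a b c = x_l * a * x_r"
proof -
  let ?x = "x_l * a * x_r"
  have xab: "x_l * a * b = b" and subr: "right_annihilator c \<subseteq> right_annihilator x_l"
    using assms(1) by (simp_all add: is_left_annihilator_inverse_def)
  have cay: "c * a * x_r = c" and subl: "left_annihilator b \<subseteq> left_annihilator x_r"
    using assms(2) by (simp_all add: is_right_annihilator_inverse_def)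
  have L: "?x * r = x_l * r" for r
    using cay subr by (rule left_inverse_absorbs)
  have R: "s * ?x = s * x_r" for s
    using xab subl by (rule right_inverse_absorbs)
  have "?x * a * ?x = ?x"
    by (simp only: R L)
  moreover have "?x * a * b = b"
    using xab by (simp only: L)
  moreover have "c * a * ?x = c"
    using cay by (simp only: R)
  moreover have "left_annihilator b \<subseteq> left_annihilator ?x"
    using subl by (simp only: left_annihilator_def R)
  moreover have "right_annihilator c \<subseteq> right_annihilator ?x"
    using subr by (simp only: right_annihilator_def L)
  ultimately have "is_annihilator_inverse a b c ?x"
    by (simp only: is_annihilator_inverse_def simp_thms)
  then show ?thesis
    using annihilator_inverse_eqI by (auto simp: annihilator_invertible_def)
qed

end
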